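(* Let $G=(V,E)$ be a strongly regular graph with parameters $(n,\kappa,\lambda,\mu)$ and restricted eigenvalues $r\ge 0$ and $s<0$. Let $k$ and $m_i$ ($i=1,\ldots,k$) be positive integers such that $\sum_{j=1}^k m_j=n$. Then the semidefinite programming bound $\mathrm{GPP}_{\mathrm m}$ for the minimum graph partition problem of $G$ is given by $$\max\left\{\frac{\kappa-r}{n}\sum_{i<j}m_im_j,\ \frac12\Big(n(\kappa+1)-\sum_i m_i^2\Big)\right\}.$$ Similarly, the semidefinite programming bound $\mathrm{GPP}_{\mathrm m}$ for the maximum graph partition problem is given by $$\min\left\{\frac{\kappa-s}{n}\sum_{i<j}m_im_j,\ \frac12\kappa n\right\}.$$
   Context: A simple, undirected, loopless $\kappa$-regular graph on $n$ vertices is strongly regular with parameters $(n,\kappa,\lambda,\mu)$ if it is neither complete nor edgeless and every two distinct vertices have $\lambda$ common neighbors if they are adjacent and $\mu$ common neighbors if they are not. Its adjacency matrix $A$ satisfies $A^2=\kappa I+\lambda A+\mu(J-I-A)$; it has exactly two distinct eigenvalues associated with eigenvectors orthogonal to the all-ones vector $u_n$, called the restricted eigenvalues and denoted $r\ge 0$ and $s<0$. The minimum (resp. maximum) graph partition problem asks for a partition of the vertex set into $k$ disjoint sets of sizes $m_1,\dots,m_k$ such that the number of edges joining different sets is minimized (resp. maximized). The bound $\mathrm{GPP}_{\mathrm m}$ for the minimum problem is the optimal value of the semidefinite program $$\min\ \tfrac12\operatorname{tr}A(J_n-Y)\quad\text{s.t.}\quad \operatorname{diag}(Y)=u_n,\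 \ \operatorname{tr}J_nY=\sum_{i=1}^k m_i^2,\ \ kY-J_n\succeq 0,\ \ Y\ge 0\ \text{(entrywise)},$$ over real symmetric $n\times n$ matrices $Y$, where $J_n$ is the all-ones matrix and $\operatorname{diag}(Y)$ is the vector of diagonal entries of $Y$. The bound $\mathrm{GPP}_{\mathrm m}$ for the maximum problem is the optimal value of the same program with $\min$ replaced by $\max$. *)

theory Defs
  imports "HOL-Analysis.Analysis"
begin

text \<open>A graph is given by its adjacency relation on a finite vertex type.\<close>

definition simple_graph :: "('v \<Rightarrow> 'v \<Rightarrow> bool) \<Rightarrow> bool" where
  "simple_graph E \<longleftrightarrow> symp E \<and> irreflp E"

definition regular_graph :: "('v::finite \<Rightarrow> 'v \<Rightarrow> bool) \<Rightarrow> nat \<Rightarrow> bool" where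
  "regular_graph E \<kappa> \<longleftrightarrow> (\<forall>x. card {y. E x y} = \<kappa>)"

definition strongly_regular ::
    "('v::finite \<Rightarrow> 'v \<Rightarrow> bool) \<Rightarrow> nat \<Rightarrow> nat \<Rightarrow> nat \<Rightarrow> nat \<Rightarrow> bool" where
  "strongly_regular E n \<kappa> l \<mu> \<longleftrightarrow>
     simple_graph E \<and> CARD('v) = n \<and> regular_graph E \<kappa> \<and>
     \<not> (\<forall>x y. x \<noteq> y \<longrightarrow> E x y) \<and> \<not> (\<forall>x y. \<not> E x y) \<and>
     (\<forall>x y. x \<noteq> y \<longrightarrow> card {z. E x z \<and> E y z} = (if E x y then l else \<mu>))"

definition adjacency_matrix :: "('v::finite \<Rightarrow> 'v \<Rightarrow> bool) \<Rightarrow> real^'v^'v" where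
  "adjacency_matrix E = (\<chi> i j. if E i j then 1 else 0)"

definition ones_vec :: "real^'v" where
  "ones_vec = (\<chi> i. 1)"

definition ones_mat :: "real^'v^'v" where
  "ones_mat = (\<chi> i j. 1)"

definition diag_vec :: "real^'v^'v \<Rightarrow> real^'v" where
  "diag_vec Y = (\<chi> i. Y $ i $ i)"

definition psd :: "real^'v^'v \<Rightarrow> bool" where
  "psd M \<longleftrightarrow> transpose M = M \<and> (\<forall>x. 0 \<le> x \<bullet> (M *v x))"

definition restricted_eigenvalue :: "('v::finite \<Rightarrow> 'v \<Rightarrow> bool) \<Rightarrow> real \<Rightarrow> bool" where
  "restricted_eigenvalue E \<theta> \<longleftrightarrow>
     (\<exists>x. x \<noteq> 0 \<and> x \<bullet> ones_vec = 0 \<and> adjacency_matrix E *v x = \<theta> *\<^sub>R x)"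

text \<open>
  The prescribed part sizes are the values of \<open>m\<close> at \<open>1, \<dots>, k\<close>; other values are ignored.
\<close>

definition GPPm_feasible :: "nat \<Rightarrow> (nat \<Rightarrow> nat) \<Rightarrow> real^'v^'v \<Rightarrow> bool" where
  "GPPm_feasible k m Y \<longleftrightarrow>
     transpose Y = Y \<and>
     diag_vec Y = ones_vec \<and>
     trace (ones_mat ** Y) = (\<Sum>i\<in>{1..k}. (real (m i))\<^sup>2) \<and>
     psd (real k *\<^sub>R Y - ones_mat) \<and>
     (\<forall>i j. 0 \<le> Y $ i $ j)"

definition GPPm_objective :: "('v::finite \<Rightarrow> 'v \<Rightarrow> bool) \<Rightarrow> real^'v^'v \<Rightarrow> real" where
  "GPPm_objective E Y = 1 / 2 * trace (adjacency_matrix E ** (ones_mat - Y))"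

text \<open>
  Optimal values are relations rather than \<open>Inf\<close>/\<open>Sup\<close>, which are unspecified on empty or
  unbounded sets of reals: here the program must be feasible and the value attained.
  There is at most one such value.
\<close>

definition is_GPPm_min ::
    "('v::finite \<Rightarrow> 'v \<Rightarrow> bool) \<Rightarrow> nat \<Rightarrow> (nat \<Rightarrow> nat) \<Rightarrow> real \<Rightarrow> bool" where
  "is_GPPm_min E k m v \<longleftrightarrow>
     (\<exists>Y. is_arg_min (GPPm_objective E) (GPPm_feasible k m) Y \<and> GPPm_objective E Y = v)"

definition is_GPPm_max ::
    "('v::finite \<Rightarrow> 'v \<Rightarrow> bool) \<Rightarrow> nat \<Rightarrow> (nat \<Rightarrow> nat) \<Rightarrow> real \<Rightarrow> bool" where
  "is_GPPm_max E k m v \<longleftrightarrow>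
     (\<exists>Y. is_arg_max (GPPm_objective E) (GPPm_feasible k m) Y \<and> GPPm_objective E Y = v)"

end

theory Submission
  imports Defs
begin

text \<open>
  Write \<open>S\<close> for the sum of the squared part sizes and
  \<open>M \<theta> = A - \<theta> I - ((\<kappa> - \<theta>) / n) J\<close>. Both \<open>P = M s\<close> and \<open>Q = - M r\<close> are \<open>r - s\<close> times
  projections, so \<open>tr P Y\<close> and \<open>tr Q Y\<close> are nonnegative for feasible \<open>Y\<close>; since \<open>tr Y = n\<close> and
  \<open>tr J Y = S\<close> these are the two spectral bounds on \<open>tr A Y\<close>. The other two bounds say that
  \<open>tr A Y\<close> and \<open>tr (J - I - A) Y\<close> are nonnegative. One of the two bounds is attained by a matrix
  \<open>(S / n\<^sup>2) J + a P + b Q\<close> with \<open>a, b \<ge> 0\<close>: for the minimum, take \<open>b = 0\<close> if the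
  resulting matrix is entrywise nonnegative, and otherwise the one that vanishes on nonedges; for
  the maximum, take \<open>a = 0\<close> or the one that vanishes on edges.
\<close>

section \<open>Matrix arithmetic, the trace inner product and positive semidefiniteness\<close>

lemma matrix_diff_ldistrib: "(A :: real^'n^'m) ** (B - C) = A ** B - A ** C"
  by (vector matrix_matrix_mult_def sum_subtractf[symmetric] field_simps)

lemma matrix_diff_rdistrib: "((A :: real^'n^'m) - B) ** C = A ** C - B ** C"
  by (vector matrix_matrix_mult_def sum_subtractf[symmetric] field_simps)

lemma matrix_add_rdistrib: "((A :: real^'n^'m) + B) ** C = A ** C + B ** C"
  by (vector matrix_matrix_mult_def sum.distrib[symmetric] field_simps)

text \<open>The inner product on \<open>real^'n^'n\<close> is the entrywise one, so the traces in
  the program become values of a symmetric bilinear form.\<close>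

lemma trace_mult_eq_inner:
  fixes A B :: "real^'n^'n"
  assumes "transpose A = A"
  shows "trace (A ** B) = A \<bullet> B"
proof -
  have "A $ i $ j = A $ j $ i" for i j
    using assms by (metis transpose_def vec_lambda_beta)
  then have "trace (A ** B) = (\<Sum>i\<in>UNIV. \<Sum>j\<in>UNIV. A $ j $ i * B $ j $ i)"
    by (simp add: trace_def matrix_matrix_mult_def)
  also have "\<dots> = A \<bullet> B"
    unfolding inner_vec_def inner_real_def by (rule sum.swap)
  finally show ?thesis .
qed

lemma inner_symmetric_matrix:
  fixes N :: "real^'n^'n"
  assumes "transpose N = N"
  shows "x \<bullet> (N *v y) = (N *v x) \<bullet> y"
  by (metis assms dot_lmul_matrix vector_transpose_matrix)

text \<open>By symmetry, \<open>c\<close> times the quadratic form of \<open>N\<close> at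
  \<open>x\<close> is the squared norm of \<open>N *v x\<close>.\<close>

lemma psd_scaled_projection:
  fixes N :: "real^'n^'n"
  assumes "transpose N = N" "N ** N = c *\<^sub>R N" "c > 0"
  shows "psd N"
proof -
  have "0 \<le> x \<bullet> (N *v x)" for x
  proof -
    have "c * (x \<bullet> (N *v x)) = x \<bullet> ((N ** N) *v x)"
      using assms(2) by (simp add: scaleR_matrix_vector_assoc[symmetric])
    also have "\<dots> = (N *v x) \<bullet> (N *v x)"
      by (metis assms(1) inner_symmetric_matrix matrix_vector_mul_assoc)
    finally have "0 \<le> c * (x \<bullet> (N *v x))"
      by simp
    then show ?thesis
      using assms(3) by (simp add: zero_le_mult_iff)
  qed
  then show ?thesis
    using assms(1) by (simp add: psd_def)
qed

text \<open>By symmetry \<open>N ** N\<close> is the sum of the outer squares of the rows of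
  \<open>N\<close>. Pairing it with \<open>Y\<close> therefore sums the quadratic form of
  \<open>Y\<close> over these rows.\<close>

lemma inner_psd_scaled_projection_nonneg:
  fixes N Y :: "real^'n^'n"
  assumes "psd Y" and sym: "transpose N = N" and "N ** N = c *\<^sub>R N" "c > 0"
  shows "0 \<le> N \<bullet> Y"
proof -
  have sym': "N $ i $ j = N $ j $ i" for i j
    using sym by (metis transpose_def vec_lambda_beta)
  have "c * (N \<bullet> Y) = (N ** N) \<bullet> Y"
    using assms(3) by simp
  also have "\<dots> = (\<Sum>i\<in>UNIV. \<Sum>j\<in>UNIV. \<Sum>q\<in>UNIV. N $ q $ i * N $ q $ j * Y $ i $ j)"
    by (simp add: inner_vec_def matrix_matrix_mult_def sum_distrib_right, subst sym') (rule refl)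
  also have "\<dots> = (\<Sum>i\<in>UNIV. \<Sum>q\<in>UNIV. \<Sum>j\<in>UNIV. N $ q $ i * N $ q $ j * Y $ i $ j)"
    by (rule sum.cong[OF refl sum.swap])
  also have "\<dots> = (\<Sum>q\<in>UNIV. \<Sum>i\<in>UNIV. \<Sum>j\<in>UNIV. N $ q $ i * N $ q $ j * Y $ i $ j)"
    by (rule sum.swap)
  also have "\<dots> = (\<Sum>q\<in>UNIV. N $ q \<bullet> (Y *v N $ q))"
    by (simp add: inner_vec_def matrix_vector_mult_def sum_distrib_left mult_ac)
  also have "\<dots> \<ge> 0"
    using assms(1) by (intro sum_nonneg) (simp add: psd_def)
  finally show ?thesis
    using assms(4) by (simp add: zero_le_mult_iff)
qed

lemma psd_add: "psd M \<Longrightarrow> psd N \<Longrightarrow> psd (M + N)"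
  by (simp add: psd_def transpose_def vec_eq_iff matrix_vector_mult_add_rdistrib inner_add_right)

lemma psd_scaleR: "psd M \<Longrightarrow> 0 \<le> c \<Longrightarrow> psd (c *\<^sub>R M)"
  by (simp add: psd_def transpose_def vec_eq_iff scaleR_matrix_vector_assoc[symmetric])

lemma ones_mat_square: "(ones_mat :: real^'v^'v) ** ones_mat = real CARD('v) *\<^sub>R ones_mat"
  by (simp add: ones_mat_def matrix_matrix_mult_def vec_eq_iff)

lemma transpose_ones_mat: "transpose ones_mat = ones_mat"
  by (simp add: ones_mat_def transpose_def)

lemma psd_ones_mat: "psd (ones_mat :: real^'v^'v)"
  by (rule psd_scaled_projection[OF transpose_ones_mat ones_mat_square]) simp

section \<open>Two scalar identities\<close>

lemma square_sum_split:
  fixes f :: "nat \<Rightarrow> real"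
  shows "(\<Sum>i\<in>{1..k}. f i)\<^sup>2 =
    (\<Sum>i\<in>{1..k}. (f i)\<^sup>2) + 2 * (\<Sum>(i, j)\<in>{(i, j). 1 \<le> i \<and> i < j \<and> j \<le> k}. f i * f j)"
proof (induction k)
  case 0
  have "{(i, j). 1 \<le> i \<and> i < j \<and> j \<le> (0::nat)} = {}"
    by auto
  then show ?case
    by (simp only: sum.empty) simp
next
  case (Suc k)
  have split: "{(i, j). 1 \<le> i \<and> i < j \<and> j \<le> Suc k} =
      {(i, j). 1 \<le> i \<and> i < j \<and> j \<le> k} \<union> (\<lambda>i. (i, Suc k)) ` {1..k}"
    by (auto simp: image_iff le_Suc_eq)
  have fin: "finite {(i, j). 1 \<le> i \<and> i < j \<and> j \<le> k}"
    by (rule finite_subset[of _ "{1..k} \<times> {1..k}"]) auto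
  have "(\<Sum>(i, j)\<in>{(i, j). 1 \<le> i \<and> i < j \<and> j \<le> Suc k}. f i * f j) =
      (\<Sum>(i, j)\<in>{(i, j). 1 \<le> i \<and> i < j \<and> j \<le> k}. f i * f j) + (\<Sum>i\<in>{1..k}. f i) * f (Suc k)"
    unfolding split using fin
    by (subst sum.union_disjoint) (auto simp: sum.reindex inj_on_def sum_distrib_right)
  then show ?case
    using Suc by (simp add: power2_sum algebra_simps)
qed

text \<open>With \<open>a = (x + c * r) / (r - s)\<close> and
  \<open>b = (x + c * s) / (r - s)\<close>, this solves \<open>a - b = c\<close> and
  \<open>b * r - a * s = x\<close>. These differences are what an edge entry and a diagonal entry of
  a candidate solution add to its nonedge entry.\<close>

lemma interpolation_coordinates:
  fixes r s :: real
  assumes "r \<noteq> s"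
  shows "(x + c * r) / (r - s) - (x + c * s) / (r - s) = c"
    and "(x + c * s) / (r - s) * r - (x + c * r) / (r - s) * s = x"
proof -
  have "(x + c * r) - (x + c * s) = c * (r - s)" "(x + c * s) * r - (x + c * r) * s = x * (r - s)"
    by (simp_all add: algebra_simps)
  then show "(x + c * r) / (r - s) - (x + c * s) / (r - s) = c"
    "(x + c * s) / (r - s) * r - (x + c * r) / (r - s) * s = x"
    using assms by (simp_all flip: diff_divide_distrib)
qed

section \<open>The adjacency algebra of a strongly regular graph\<close>

locale strongly_regular_spectrum =
  fixes E :: "'v::finite \<Rightarrow> 'v \<Rightarrow> bool" and n \<kappa> l \<mu> :: nat and r s :: real
  assumes srg: "strongly_regular E n \<kappa> l \<mu>"
    and eigen_r: "restricted_eigenvalue E r" and r_nonneg: "0 \<le> r"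
    and eigen_s: "restricted_eigenvalue E s" and s_neg: "s < 0"
begin

abbreviation A :: "real^'v^'v" where "A \<equiv> adjacency_matrix E"
abbreviation J :: "real^'v^'v" where "J \<equiv> ones_mat"

lemma card_vertices: "CARD('v) = n"
  and sym: "E x y \<longleftrightarrow> E y x"
  and irrefl: "\<not> E x x"
  and degree: "card {y. E x y} = \<kappa>"
  and common: "x \<noteq> y \<Longrightarrow> card {z. E x z \<and> E y z} = (if E x y then l else \<mu>)"
  using srg by (auto simp: strongly_regular_def simple_graph_def regular_graph_def
    irreflp_def dest: sympD)

lemma degree_pos: "0 < \<kappa>"
proof -
  obtain x y where "E x y"
    using srg by (auto simp: strongly_regular_def)
  then have "card {y. E x y} > 0"
    by (auto simp: card_gt_0_iff)
  then show ?thesis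
    by (simp add: degree)
qed

text \<open>A vertex, its neighbors and one further vertex are all distinct. The strict bound later
  permits division by \<open>n - \<kappa> - 1\<close>.\<close>

lemma degree_less: "\<kappa> + 1 < n"
proof -
  obtain x y where xy: "x \<noteq> y" "\<not> E x y"
    using srg by (auto simp: strongly_regular_def)
  have "insert x (insert y {z. E x z}) \<subseteq> UNIV"
    by simp
  then have "card (insert x (insert y {z. E x z})) \<le> CARD('v)"
    by (rule card_mono[OF finite])
  then show ?thesis
    using xy by (simp add: card_vertices degree irrefl)
qed

lemma transpose_A: "transpose A = A"
  by (simp add: adjacency_matrix_def transpose_def sym vec_eq_iff)

lemma sum_indicator: "(\<Sum>y\<in>UNIV. if P y then 1 else 0) = real (card {y :: 'v. P y})"
  by (simp add: sum.If_cases)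

lemma A_J: "A ** J = real \<kappa> *\<^sub>R J"
  by (simp add: adjacency_matrix_def ones_mat_def matrix_matrix_mult_def vec_eq_iff
      sum_indicator degree)

lemma J_A: "J ** A = real \<kappa> *\<^sub>R J"
proof -
  have "transpose (A ** J) = transpose (real \<kappa> *\<^sub>R J)"
    by (simp only: A_J)
  then show ?thesis
    by (simp add: matrix_transpose_mul transpose_A transpose_ones_mat transpose_scalar)
qed

lemma J_J: "J ** J = real n *\<^sub>R J"
  using ones_mat_square[where 'v = 'v] by (simp add: card_vertices)

lemma A_square: "A ** A = real \<kappa> *\<^sub>R mat 1 + real l *\<^sub>R A + real \<mu> *\<^sub>R (J - mat 1 - A)"
proof -
  have "(A ** A) $ x $ y = real (card {z. E x z \<and> E y z})" for x y
  proof -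
    have "(A ** A) $ x $ y = (\<Sum>z\<in>UNIV. if E x z \<and> E y z then 1 else 0)"
      unfolding matrix_matrix_mult_def adjacency_matrix_def
      by (simp, rule sum.cong) (auto simp: sym[of _ y])
    then show ?thesis
      by (simp add: sum_indicator)
  qed
  moreover have "real (card {z. E x z \<and> E y z}) =
      (real \<kappa> *\<^sub>R mat 1 + real l *\<^sub>R A + real \<mu> *\<^sub>R (J - mat 1 - A)) $ x $ y" for x y
    by (cases "x = y") (auto simp: common degree irrefl adjacency_matrix_def ones_mat_def mat_def)
  ultimately show ?thesis
    by (simp add: vec_eq_iff)
qed

text \<open>Apply the quadratic equation for \<open>A\<close> to the eigenvector; \<open>J\<close>
  annihilates it by orthogonality.\<close>

lemma restricted_eigenvalue_root:
  assumes "restricted_eigenvalue E \<theta>"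
  shows "\<theta>\<^sup>2 = real \<kappa> - real \<mu> + (real l - real \<mu>) * \<theta>"
proof -
  obtain x where x: "x \<noteq> 0" "x \<bullet> ones_vec = 0" "A *v x = \<theta> *\<^sub>R x"
    using assms by (auto simp: restricted_eigenvalue_def)
  have Jx: "J *v x = 0"
    using x(2) by (simp add: ones_mat_def ones_vec_def matrix_vector_mult_def inner_vec_def vec_eq_iff)
  have "\<theta>\<^sup>2 *\<^sub>R x = A *v (A *v x)"
    using x(3) by (simp add: matrix_vector_mult_scaleR power2_eq_square)
  also have "\<dots> = (A ** A) *v x"
    by (simp add: matrix_vector_mul_assoc)
  also have "\<dots> = (real \<kappa> - real \<mu> + (real l - real \<mu>) * \<theta>) *\<^sub>R x"
    unfolding A_square
    by (simp add: matrix_vector_mult_add_rdistrib matrix_vector_mult_diff_rdistrib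
        scaleR_matrix_vector_assoc[symmetric] x(3) Jx algebra_simps)
  finally show ?thesis
    using x(1) by simp
qed

text \<open>Vieta's formulas: both numbers are roots of one monic quadratic, and they differ in sign
  class since \<open>s < 0\<close> and \<open>0 \<le> r\<close>.\<close>

lemma eigenvalue_sum: "r + s = real l - real \<mu>"
  and eigenvalue_prod: "r * s = real \<mu> - real \<kappa>"
proof -
  have "(r - s) * (r + s - (real l - real \<mu>)) = 0"
    using restricted_eigenvalue_root[OF eigen_r] restricted_eigenvalue_root[OF eigen_s]
    by (simp add: algebra_simps power2_eq_square)
  then show sum: "r + s = real l - real \<mu>"
    using r_nonneg s_neg by simp
  have "r\<^sup>2 = real \<kappa> - real \<mu> + (r + s) * r"
    using restricted_eigenvalue_root[OF eigen_r] sum by simp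
  then show "r * s = real \<mu> - real \<kappa>"
    by (simp add: algebra_simps power2_eq_square)
qed

text \<open>Evaluating \<open>A ** A ** J\<close> in two ways gives the counting identity
  \<open>\<kappa> * (\<kappa> - l - 1) = \<mu> * (n - \<kappa> - 1)\<close>, which Vieta's formulas
  bring into this form.\<close>

lemma n_mu: "real n * real \<mu> = (real \<kappa> - r) * (real \<kappa> - s)"
proof -
  have "(A ** A) ** J = (real \<kappa> * real \<kappa>) *\<^sub>R J"
    by (simp add: matrix_mul_assoc[symmetric] A_J matrix_scalar_ac scalar_matrix_assoc[symmetric])
  also have "(A ** A) ** J = (real \<kappa> + real l * real \<kappa> + real \<mu> * (real n - 1 - real \<kappa>)) *\<^sub>R J"
    unfolding A_square
    by (simp add: matrix_add_rdistrib matrix_diff_rdistrib scalar_matrix_assoc[symmetric] A_J J_J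
        algebra_simps)
  finally have "real \<kappa> + real l * real \<kappa> + real \<mu> * (real n - 1 - real \<kappa>) = real \<kappa> * real \<kappa>"
    by (simp add: ones_mat_def vec_eq_iff)
  moreover have "(real \<kappa> - r) * (real \<kappa> - s) = real \<kappa> * real \<kappa> - (r + s) * real \<kappa> + r * s"
    by (simp add: algebra_simps)
  ultimately show ?thesis
    unfolding eigenvalue_sum eigenvalue_prod by (simp add: algebra_simps)
qed

text \<open>For the two restricted eigenvalues, \<open>eigen_shift s\<close> and \<open>- eigen_shift r\<close> are \<open>r - s\<close>
  times the orthogonal projections onto the eigenspaces of \<open>r\<close> and \<open>s\<close>, respectively.\<close>

definition eigen_shift :: "real \<Rightarrow> real^'v^'v" where
  "eigen_shift \<theta> = A - \<theta> *\<^sub>R mat 1 - ((real \<kappa> - \<theta>) / real n) *\<^sub>R J"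

lemma n_pos: "0 < real n"
  using degree_less by simp

lemma transpose_eigen_shift: "transpose (eigen_shift \<theta>) = eigen_shift \<theta>"
  using sym by (auto simp: eigen_shift_def vec_eq_iff transpose_def adjacency_matrix_def ones_mat_def mat_def)

text \<open>Eliminates \<open>l\<close> and \<open>\<mu>\<close>: the product of
  \<open>A - r I\<close> and \<open>A - s I\<close> is a multiple of \<open>J\<close>.\<close>

lemma A_A: "A ** A = (r + s) *\<^sub>R A - (r * s) *\<^sub>R mat 1 + ((real \<kappa> - r) * (real \<kappa> - s) / real n) *\<^sub>R J"
proof -
  have mu: "(real \<kappa> - r) * (real \<kappa> - s) / real n = real \<mu>"
    using n_mu n_pos by (simp add: field_simps)
  have "A ** A = (real l - real \<mu>) *\<^sub>R A - (real \<mu> - real \<kappa>) *\<^sub>R mat 1 + real \<mu> *\<^sub>R J"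
    unfolding A_square by (simp add: scaleR_diff_left scaleR_diff_right)
  then show ?thesis
    unfolding mu eigenvalue_sum eigenvalue_prod .
qed

text \<open>The rows of \<open>A - \<theta> I\<close> sum to \<open>\<kappa> - \<theta>\<close>, and
  the coefficient of \<open>J\<close> is chosen to cancel this.\<close>

lemma eigen_shift_J: "eigen_shift \<theta> ** J = 0"
  using n_pos unfolding eigen_shift_def
  by (simp add: matrix_diff_rdistrib scalar_matrix_assoc[symmetric] A_J J_J
      flip: scaleR_diff_left)

lemma eigen_shift_mult:
  "eigen_shift a ** eigen_shift b =
    (r + s - a - b) *\<^sub>R A + (a * b - r * s) *\<^sub>R mat 1 +
    (((real \<kappa> - r) * (real \<kappa> - s) - (real \<kappa> - a) * (real \<kappa> - b)) / real n) *\<^sub>R J"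
proof -
  \<comment> \<open>Only the second factor is unfolded; its \<open>J\<close> part is annihilated by
    the first factor.\<close>
  have "eigen_shift a ** eigen_shift b = eigen_shift a ** (A - b *\<^sub>R mat 1)"
    by (subst (2) eigen_shift_def) (simp add: matrix_diff_ldistrib matrix_scalar_ac
      scalar_matrix_assoc[symmetric] eigen_shift_J)
  also have "\<dots> = A ** A - (a + b) *\<^sub>R A + (a * b) *\<^sub>R mat 1
      - ((real \<kappa> - a) / real n * (real \<kappa> - b)) *\<^sub>R J"
    unfolding eigen_shift_def using n_pos
    by (simp add: matrix_diff_ldistrib matrix_diff_rdistrib matrix_scalar_ac
      scalar_matrix_assoc[symmetric] J_A vec_eq_iff)
      (simp add: ones_mat_def field_simps)
  also have "\<dots> = (r + s - a - b) *\<^sub>R A + (a * b - r * s) *\<^sub>R mat 1 +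
    (((real \<kappa> - r) * (real \<kappa> - s) - (real \<kappa> - a) * (real \<kappa> - b)) / real n) *\<^sub>R J"
    unfolding A_A using n_pos
    by (simp add: vec_eq_iff ones_mat_def) (simp add: field_simps)
  finally show ?thesis .
qed

lemma eigen_shift_s_square: "eigen_shift s ** eigen_shift s = (r - s) *\<^sub>R eigen_shift s"
  and eigen_shift_r_square: "(- eigen_shift r) ** (- eigen_shift r) = (r - s) *\<^sub>R (- eigen_shift r)"
  and eigen_shift_r_s: "eigen_shift r ** eigen_shift s = 0"
proof -
  have neg: "(- M) ** (- M) = M ** M" for M :: "real^'v^'v"
    by (simp add: matrix_matrix_mult_def vec_eq_iff)
  show "eigen_shift s ** eigen_shift s = (r - s) *\<^sub>R eigen_shift s"
    unfolding eigen_shift_mult using n_pos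
    by (simp add: eigen_shift_def vec_eq_iff ones_mat_def) (simp add: field_simps)
  show "(- eigen_shift r) ** (- eigen_shift r) = (r - s) *\<^sub>R (- eigen_shift r)"
    unfolding neg eigen_shift_mult using n_pos
    by (simp add: eigen_shift_def vec_eq_iff ones_mat_def) (simp add: field_simps)
  show "eigen_shift r ** eigen_shift s = 0"
    unfolding eigen_shift_mult by simp
qed


lemma spectral_gap_pos: "0 < r - s"
  using r_nonneg s_neg by simp

lemma transpose_neg_eigen_shift: "transpose (- eigen_shift \<theta>) = - eigen_shift \<theta>"
  using transpose_eigen_shift by (simp add: transpose_def vec_eq_iff)

lemma psd_eigen_shift_s: "psd (eigen_shift s)"
  by (rule psd_scaled_projection[OF transpose_eigen_shift eigen_shift_s_square spectral_gap_pos])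

lemma psd_neg_eigen_shift_r: "psd (- eigen_shift r)"
  by (rule psd_scaled_projection[OF transpose_neg_eigen_shift eigen_shift_r_square spectral_gap_pos])

lemma eigen_shift_entry:
  "eigen_shift \<theta> $ x $ y =
    (if E x y then 1 else 0) - (if x = y then \<theta> else 0) - (real \<kappa> - \<theta>) / real n"
  by (simp add: eigen_shift_def adjacency_matrix_def ones_mat_def mat_def)

text \<open>This is the diagonal entry of \<open>eigen_shift s\<close>. Times \<open>r - s\<close>
  it is the squared norm of a row, and that row has a nonzero entry at a nonneighbor because
  \<open>s < 0 \<le> \<kappa>\<close>.\<close>

lemma eigen_shift_s_diag_pos: "0 < - s - (real \<kappa> - s) / real n"
proof -
  obtain x y where xy: "x \<noteq> y" "\<not> E x y"
    using srg by (auto simp: strongly_regular_def)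
  have "0 < ((real \<kappa> - s) / real n)\<^sup>2"
    using s_neg n_pos by simp
  also have "\<dots> = (eigen_shift s $ x $ y)\<^sup>2"
    using xy by (simp add: eigen_shift_entry power_divide power2_commute[of s])
  also have "\<dots> \<le> (\<Sum>z\<in>UNIV. (eigen_shift s $ x $ z)\<^sup>2)"
    by (rule member_le_sum) simp_all
  also have "\<dots> = (eigen_shift s ** eigen_shift s) $ x $ x"
    by (simp add: matrix_matrix_mult_def power2_eq_square)
      (rule sum.cong, auto simp: eigen_shift_entry sym)
  also have "\<dots> = (r - s) * (- s - (real \<kappa> - s) / real n)"
    by (simp add: eigen_shift_s_square eigen_shift_entry irrefl)
  finally show ?thesis
    using spectral_gap_pos by (simp add: zero_less_mult_iff)
qed

section \<open>Inner products of the basic matrices\<close>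

lemma A_inner_J: "A \<bullet> J = real \<kappa> * real n"
  by (simp add: inner_vec_def ones_mat_def adjacency_matrix_def sum_indicator degree card_vertices)

lemma J_inner_J: "J \<bullet> J = (real n)\<^sup>2"
  by (simp add: inner_vec_def ones_mat_def card_vertices power2_eq_square)

lemma eigen_shift_inner_J: "eigen_shift \<theta> \<bullet> J = 0"
  by (simp add: trace_mult_eq_inner[OF transpose_eigen_shift, symmetric] eigen_shift_J trace_def)

lemma J_inner_eigen_shift: "J \<bullet> eigen_shift \<theta> = 0"
  by (metis eigen_shift_inner_J inner_commute)

lemma eigen_shift_inner_r_s: "eigen_shift r \<bullet> eigen_shift s = 0"
  by (simp add: trace_mult_eq_inner[OF transpose_eigen_shift, symmetric] eigen_shift_r_s trace_def)

lemma objective_inner: "GPPm_objective E Y = (real \<kappa> * real n - A \<bullet> Y) / 2"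
  by (simp add: GPPm_objective_def trace_mult_eq_inner[OF transpose_A] inner_diff_right A_inner_J)

end

section \<open>The part sizes\<close>

locale strongly_regular_partition = strongly_regular_spectrum E n \<kappa> l \<mu> r s
  for E :: "'v::finite \<Rightarrow> 'v \<Rightarrow> bool" and n \<kappa> l \<mu> :: nat and r s :: real +
  fixes k :: nat and m :: "nat \<Rightarrow> nat"
  assumes k_pos: "0 < k"
    and m_pos: "\<And>i. i \<in> {1..k} \<Longrightarrow> 0 < m i"
    and m_sum: "(\<Sum>j\<in>{1..k}. m j) = n"
begin

definition S :: real where "S = (\<Sum>i\<in>{1..k}. (real (m i))\<^sup>2)"

lemma sum_real_m: "(\<Sum>i\<in>{1..k}. real (m i)) = real n"
  by (simp flip: m_sum)

lemma S_ge: "real n \<le> S"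
proof -
  have "real (m i) \<le> (real (m i))\<^sup>2" if "i \<in> {1..k}" for i
    using m_pos[OF that] by (simp add: power2_eq_square)
  then show ?thesis
    unfolding S_def sum_real_m[symmetric] by (rule sum_mono)
qed

text \<open>Cauchy-Schwarz. It makes the \<open>J\<close> component of
  \<open>real k *\<^sub>R Y - J\<close> nonnegative for the candidate solutions.\<close>

lemma n_square_le: "(real n)\<^sup>2 \<le> real k * S"
  using sum_squared_le_sum_of_squares[of "\<lambda>i. real (m i)" "{1..k}"]
  unfolding sum_real_m S_def by (simp add: mult.commute)

lemma cross_sum:
  "(\<Sum>(i, j)\<in>{(i, j). 1 \<le> i \<and> i < j \<and> j \<le> k}. real (m i) * real (m j)) = ((real n)\<^sup>2 - S) / 2"
  using square_sum_split[of "\<lambda>i. real (m i)" k] unfolding sum_real_m S_def by simp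

lemma S_le: "S \<le> (real n)\<^sup>2"
proof -
  have "0 \<le> (\<Sum>(i, j)\<in>{(i, j). 1 \<le> i \<and> i < j \<and> j \<le> k}. real (m i) * real (m j))"
    by (rule sum_nonneg) auto
  then show ?thesis
    unfolding cross_sum by simp
qed

section \<open>Bounds on the objective at every feasible matrix\<close>

context
  fixes Y :: "real^'v^'v"
  assumes feasible: "GPPm_feasible k m Y"
begin

lemma feasible_entry_nonneg: "0 \<le> Y $ i $ j"
  using feasible by (simp add: GPPm_feasible_def)

lemma feasible_diag: "Y $ i $ i = 1"
  using feasible by (simp add: GPPm_feasible_def diag_vec_def ones_vec_def vec_eq_iff)

lemma J_inner_feasible: "J \<bullet> Y = S"
  using feasible by (simp add: GPPm_feasible_def S_def trace_mult_eq_inner[OF transpose_ones_mat])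

lemma mat1_inner_feasible: "mat 1 \<bullet> Y = real n"
proof -
  have "mat 1 \<bullet> Y = trace (mat 1 ** Y)"
    by (rule trace_mult_eq_inner[symmetric]) (simp add: transpose_mat)
  then show ?thesis
    by (simp add: trace_def feasible_diag card_vertices)
qed

lemma psd_feasible: "psd Y"
proof -
  have "psd ((1 / real k) *\<^sub>R ((real k *\<^sub>R Y - J) + J))"
    using feasible by (intro psd_scaleR psd_add psd_ones_mat) (simp_all add: GPPm_feasible_def)
  then show ?thesis
    using k_pos by simp
qed

text \<open>For \<open>\<theta> = r\<close> and \<open>\<theta> = s\<close> the first term is a
  spectral bound, so the last term is the slack, and a feasible matrix attains the bound exactly
  when it vanishes.\<close>

lemma feasible_objective_eq:
  "GPPm_objective E Y = (real \<kappa> - \<theta>) / real n * (((real n)\<^sup>2 - S) / 2) - (eigen_shift \<theta> \<bullet> Y) / 2"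
proof -
  have "eigen_shift \<theta> \<bullet> Y = A \<bullet> Y - \<theta> * real n - (real \<kappa> - \<theta>) / real n * S"
    by (simp add: eigen_shift_def inner_diff_left J_inner_feasible mat1_inner_feasible)
  then show ?thesis
    using n_pos unfolding objective_inner by (simp add: field_simps power2_eq_square)
qed

lemma objective_ge_spectral:
  "(real \<kappa> - r) / real n * (((real n)\<^sup>2 - S) / 2) \<le> GPPm_objective E Y"
  using inner_psd_scaled_projection_nonneg[OF psd_feasible transpose_neg_eigen_shift
      eigen_shift_r_square spectral_gap_pos]
  unfolding feasible_objective_eq[of r] by simp

lemma objective_le_spectral:
  "GPPm_objective E Y \<le> (real \<kappa> - s) / real n * (((real n)\<^sup>2 - S) / 2)"
  using inner_psd_scaled_projection_nonneg[OF psd_feasible transpose_eigen_shift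
      eigen_shift_s_square spectral_gap_pos]
  unfolding feasible_objective_eq[of s] by simp

text \<open>The slack in the linear lower bound is half the sum of the entries of \<open>Y\<close>
  at ordered pairs of distinct nonadjacent vertices.\<close>

lemma objective_complement:
  "GPPm_objective E Y = 1 / 2 * (real n * (real \<kappa> + 1) - S) + ((J - mat 1 - A) \<bullet> Y) / 2"
  unfolding objective_inner inner_diff_left J_inner_feasible mat1_inner_feasible
  by (simp add: field_simps)

lemma objective_ge_linear: "1 / 2 * (real n * (real \<kappa> + 1) - S) \<le> GPPm_objective E Y"
proof -
  have "0 \<le> (J - mat 1 - A) $ i $ j * Y $ i $ j" for i j
    using feasible_entry_nonneg irrefl
    by (auto simp: ones_mat_def mat_def adjacency_matrix_def)
  then have "0 \<le> (J - mat 1 - A) \<bullet> Y"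
    unfolding inner_vec_def inner_real_def by (intro sum_nonneg)
  then show ?thesis
    unfolding objective_complement by simp
qed

lemma objective_le_linear: "GPPm_objective E Y \<le> 1 / 2 * real \<kappa> * real n"
proof -
  have "0 \<le> A $ i $ j * Y $ i $ j" for i j
    using feasible_entry_nonneg by (simp add: adjacency_matrix_def)
  then have "0 \<le> A \<bullet> Y"
    unfolding inner_vec_def inner_real_def by (intro sum_nonneg)
  then show ?thesis
    unfolding objective_inner by simp
qed

end

section \<open>Feasible matrices attaining the bounds\<close>

text \<open>The coefficient of \<open>J\<close> is forced by \<open>J \<bullet> Y = S\<close>, since
  every \<open>eigen_shift\<close> is orthogonal to \<open>J\<close>.\<close>

definition weight :: real where "weight = S / (real n)\<^sup>2"

text \<open>Optimal solutions are found in the adjacency algebra. In these spectral coordinates the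
  semidefinite constraint is just nonnegativity of \<open>a\<close> and \<open>b\<close>.\<close>

definition candidate :: "real \<Rightarrow> real \<Rightarrow> real^'v^'v" where
  "candidate a b = weight *\<^sub>R J + a *\<^sub>R eigen_shift s + b *\<^sub>R (- eigen_shift r)"

definition nonedge_entry :: "real \<Rightarrow> real \<Rightarrow> real" where
  "nonedge_entry a b = weight - a * ((real \<kappa> - s) / real n) + b * ((real \<kappa> - r) / real n)"

lemma candidate_entry:
  "candidate a b $ x $ y = nonedge_entry a b +
    (if E x y then a - b else if x = y then b * r - a * s else 0)"
  using irrefl by (auto simp: candidate_def nonedge_entry_def eigen_shift_entry ones_mat_def
      algebra_simps)

text \<open>In spectral coordinates \<open>real k *\<^sub>R candidate a b - J\<close> has the
  coefficients \<open>k * weight - 1\<close>, \<open>k * a\<close> and \<open>k * b\<close>. The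
  remaining conditions concern the three values an entry can take.\<close>

lemma candidate_feasible:
  assumes "0 \<le> a" "0 \<le> b"
    and diag: "nonedge_entry a b + b * r - a * s = 1"
    and nonedge: "0 \<le> nonedge_entry a b"
    and edge: "0 \<le> nonedge_entry a b + a - b"
  shows "GPPm_feasible k m (candidate a b)"
  unfolding GPPm_feasible_def
proof (intro conjI allI)
  show "transpose (candidate a b) = candidate a b"
    by (auto simp: transpose_def vec_eq_iff candidate_entry sym)
  show "diag_vec (candidate a b) = ones_vec"
    using diag by (simp add: diag_vec_def ones_vec_def vec_eq_iff candidate_entry irrefl)
  have "J \<bullet> candidate a b = S"
    using n_pos by (simp add: candidate_def inner_add_right inner_diff_right J_inner_eigen_shift
        J_inner_J weight_def)
  then show "trace (J ** candidate a b) = (\<Sum>i\<in>{1..k}. (real (m i))\<^sup>2)"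
    by (simp add: trace_mult_eq_inner[OF transpose_ones_mat] S_def)
  have "0 \<le> real k * weight - 1"
    using n_square_le n_pos by (simp add: weight_def field_simps)
  then have "psd ((real k * weight - 1) *\<^sub>R J + (real k * a) *\<^sub>R eigen_shift s
      + (real k * b) *\<^sub>R (- eigen_shift r))"
    using assms(1,2)
    by (intro psd_add psd_scaleR psd_ones_mat psd_eigen_shift_s psd_neg_eigen_shift_r) simp_all
  then show "psd (real k *\<^sub>R candidate a b - J)"
    by (simp add: candidate_def algebra_simps)
  show "0 \<le> candidate a b $ i $ j" for i j
    using nonedge edge diag by (simp add: candidate_entry)
qed

text \<open>A disjunction suffices: every feasible value is at least both bounds, so attaining
  either one attains their maximum.\<close>

lemma exists_min:
  "\<exists>Y. GPPm_feasible k m Y \<and>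
    (GPPm_objective E Y = (real \<kappa> - r) / real n * (((real n)\<^sup>2 - S) / 2) \<or>
     GPPm_objective E Y = 1 / 2 * (real n * (real \<kappa> + 1) - S))"
\<comment> \<open>The condition says that the nonedge entry of the candidate with
  \<open>b = 0\<close> is nonnegative; its failure yields \<open>b \<ge> 0\<close> for the candidate
  that vanishes on nonedges.\<close>
proof (cases "real n * (real \<kappa> - s) \<le> - s * S")
  case True
  \<comment> \<open>\<open>p\<close> is the diagonal entry of \<open>eigen_shift s\<close>, so the
    unit diagonal forces \<open>a\<close>.\<close>
  define p where "p = - s - (real \<kappa> - s) / real n"
  define a where "a = (1 - weight) / p"
  have p: "0 < p"
    using eigen_shift_s_diag_pos by (simp add: p_def)
  have a: "0 \<le> a"
    using S_le p n_pos by (simp add: a_def weight_def)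
  have ap: "a * p = 1 - weight"
    using p by (simp add: a_def)
  have diag: "nonedge_entry a 0 + 0 * r - a * s = 1"
    using ap unfolding nonedge_entry_def p_def by (simp add: algebra_simps)
  have "nonedge_entry a 0 * p = weight * p - (a * p) * ((real \<kappa> - s) / real n)"
    by (simp add: nonedge_entry_def algebra_simps)
  also have "\<dots> = - s * weight - (real \<kappa> - s) / real n"
    unfolding ap
    by (simp add: p_def diff_divide_distrib add_divide_distrib algebra_simps)
  also have "\<dots> = (- s * S - real n * (real \<kappa> - s)) / (real n)\<^sup>2"
    using n_pos by (simp add: weight_def field_simps power2_eq_square)
  also have "\<dots> \<ge> 0"
    using True by (intro divide_nonneg_nonneg) simp_all
  finally have "0 \<le> nonedge_entry a 0 * p" .
  then have nonedge: "0 \<le> nonedge_entry a 0"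
    using p by (simp add: zero_le_mult_iff)
  have feas: "GPPm_feasible k m (candidate a 0)"
    using a diag nonedge by (intro candidate_feasible) simp_all
  have "eigen_shift r \<bullet> candidate a 0 = 0"
    by (simp add: candidate_def inner_add_right eigen_shift_inner_J eigen_shift_inner_r_s)
  then show ?thesis
    using feas feasible_objective_eq[OF feas, of r] by auto
next
  case False
  \<comment> \<open>If the nonedge entries vanish, the off-diagonal sum \<open>S - n\<close> is
    shared equally by the \<open>\<kappa> * n\<close> ordered adjacent pairs. Interpolation then
    gives edge entry \<open>c\<close> and diagonal entry \<open>1\<close>.\<close>
  define c where "c = (S - real n) / (real \<kappa> * real n)"
  define a where "a = (1 + c * r) / (r - s)"
  define b where "b = (1 + c * s) / (r - s)"
  have c: "0 \<le> c"
    using S_ge by (simp add: c_def)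
  have a: "0 \<le> a"
    using c r_nonneg spectral_gap_pos by (simp add: a_def)
  have "0 \<le> 1 + c * s"
    using False degree_pos n_pos by (simp add: c_def field_simps)
  then have b: "0 \<le> b"
    using spectral_gap_pos by (simp add: b_def)
  have ab: "a - b = c" "b * r - a * s = 1"
    unfolding a_def b_def using spectral_gap_pos by (intro interpolation_coordinates; simp)+
  \<comment> \<open>This compares row sums: \<open>n * weight\<close> on one side, and
    \<open>n\<close> nonedge entries plus the offsets on \<open>\<kappa>\<close> edges and the
    diagonal on the other.\<close>
  have "nonedge_entry a b = weight - (real \<kappa> * (a - b) + (b * r - a * s)) / real n"
    by (simp add: nonedge_entry_def diff_divide_distrib add_divide_distrib algebra_simps)
  also have "\<dots> = 0"
    unfolding ab using degree_pos n_pos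
    by (simp add: c_def weight_def field_simps power2_eq_square)
  finally have nonedge: "nonedge_entry a b = 0" .
  have feas: "GPPm_feasible k m (candidate a b)"
    using a b c ab nonedge by (intro candidate_feasible) simp_all
  have "(J - mat 1 - A) $ x $ y * candidate a b $ x $ y = 0" for x y
    using nonedge irrefl
    by (auto simp: candidate_entry ones_mat_def mat_def adjacency_matrix_def)
  then have "(J - mat 1 - A) \<bullet> candidate a b = 0"
    unfolding inner_vec_def inner_real_def by (intro sum.neutral ballI)
  then show ?thesis
    using feas objective_complement[OF feas] by auto
qed

lemma exists_max:
  "\<exists>Y. GPPm_feasible k m Y \<and>
    (GPPm_objective E Y = (real \<kappa> - s) / real n * (((real n)\<^sup>2 - S) / 2) \<or>
     GPPm_objective E Y = 1 / 2 * real \<kappa> * real n)"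
\<comment> \<open>Here the condition is nonnegativity of the edge entry for \<open>a = 0\<close>;
  its failure yields \<open>a \<ge> 0\<close> for the candidate that vanishes on edges.\<close>
proof (cases "real n * (real n - real \<kappa> + r) \<le> S * (r + 1)")
  case True
  \<comment> \<open>\<open>q\<close> is the diagonal entry of
    \<open>- eigen_shift r\<close>.\<close>
  define q where "q = r + (real \<kappa> - r) / real n"
  define b where "b = (1 - weight) / q"
  have q: "0 < q"
  proof -
    have "q * real n = r * (real n - 1) + real \<kappa>"
      using n_pos by (simp add: q_def field_simps)
    also have "\<dots> > 0"
      using r_nonneg degree_less degree_pos by (intro add_nonneg_pos) simp_all
    finally show ?thesis
      using n_pos by (simp add: zero_less_mult_iff)
  qed
  have b: "0 \<le> b"
    using S_le q n_pos by (simp add: b_def weight_def)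
  have bq: "b * q = 1 - weight"
    using q by (simp add: b_def)
  have diag: "nonedge_entry 0 b + b * r - 0 * s = 1"
    using bq unfolding nonedge_entry_def q_def by (simp add: algebra_simps)
  have "(nonedge_entry 0 b - b) * q = weight * q + (b * q) * ((real \<kappa> - r) / real n - 1)"
    by (simp add: nonedge_entry_def algebra_simps)
  also have "\<dots> = weight * (r + 1) - (real n - real \<kappa> + r) / real n"
    unfolding bq using n_pos by (simp add: q_def field_simps)
  also have "\<dots> = (S * (r + 1) - real n * (real n - real \<kappa> + r)) / (real n)\<^sup>2"
    using n_pos by (simp add: weight_def field_simps power2_eq_square)
  also have "\<dots> \<ge> 0"
    using True by (intro divide_nonneg_nonneg) simp_all
  finally have "0 \<le> (nonedge_entry 0 b - b) * q" .
  then have edge: "0 \<le> nonedge_entry 0 b - b"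
    using q by (simp add: zero_le_mult_iff)
  \<comment> \<open>The nonedge entry exceeds the edge entry by \<open>b \<ge> 0\<close>, so it is
    nonnegative too.\<close>
  have feas: "GPPm_feasible k m (candidate 0 b)"
    using b diag edge by (intro candidate_feasible) simp_all
  have "eigen_shift s \<bullet> candidate 0 b = 0"
    by (simp add: candidate_def inner_diff_right eigen_shift_inner_J
        inner_commute[of "eigen_shift s" "eigen_shift r"] eigen_shift_inner_r_s)
  then show ?thesis
    using feas feasible_objective_eq[OF feas, of s] by auto
next
  case False
  \<comment> \<open>Now \<open>S - n\<close> is shared by the \<open>n * (n - \<kappa> - 1)\<close>
    ordered nonadjacent pairs. With nonedge entry \<open>c\<close>, the offsets \<open>- c\<close>
    and \<open>1 - c\<close> give edge entry \<open>0\<close> and diagonal entry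
    \<open>1\<close>.\<close>
  define c where "c = (S - real n) / (real n * (real n - real \<kappa> - 1))"
  define a where "a = ((1 - c) + - c * r) / (r - s)"
  define b where "b = ((1 - c) + - c * s) / (r - s)"
  have d: "0 < real n - real \<kappa> - 1"
    using degree_less by simp
  have c: "0 \<le> c"
    using S_ge d n_pos by (simp add: c_def)
  have r_bound: "c * (r + 1) \<le> 1"
  proof -
    have D: "0 < real n * (real n - real \<kappa> - 1)"
      using d n_pos by simp
    have "(S - real n) * (r + 1) \<le> real n * (real n - real \<kappa> - 1)"
      using False by (simp add: algebra_simps)
    then have "(S - real n) * (r + 1) / (real n * (real n - real \<kappa> - 1)) \<le> 1"
      using D by (simp only: divide_le_eq_1_pos)
    then show ?thesis
      by (simp only: c_def times_divide_eq_left)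
  qed
  have "c * (s + 1) \<le> c * (r + 1)"
    using c spectral_gap_pos by (intro mult_left_mono) simp_all
  with r_bound have s_bound: "c * (s + 1) \<le> 1"
    by simp
  have a: "0 \<le> a"
    using r_bound spectral_gap_pos by (simp add: a_def algebra_simps)
  have b: "0 \<le> b"
    using s_bound spectral_gap_pos by (simp add: b_def algebra_simps)
  have ab: "a - b = - c" "b * r - a * s = 1 - c"
    unfolding a_def b_def using spectral_gap_pos by (intro interpolation_coordinates; simp)+
  have "nonedge_entry a b = weight - (real \<kappa> * (a - b) + (b * r - a * s)) / real n"
    by (simp add: nonedge_entry_def diff_divide_distrib add_divide_distrib algebra_simps)
  also have "\<dots> = weight - (1 - c * (real \<kappa> + 1)) / real n"
    unfolding ab by (simp add: algebra_simps)
  also have "\<dots> = c"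
  proof -
    have "c * (real n * (real n - real \<kappa> - 1)) = S - real n"
      using d n_pos by (simp add: c_def)
    then show ?thesis
      using n_pos by (simp add: weight_def field_simps power2_eq_square)
  qed
  finally have nonedge: "nonedge_entry a b = c" .
  have feas: "GPPm_feasible k m (candidate a b)"
    using a b c ab nonedge by (intro candidate_feasible) simp_all
  have "A $ x $ y * candidate a b $ x $ y = 0" for x y
    using nonedge ab by (simp add: candidate_entry adjacency_matrix_def)
  then have "A \<bullet> candidate a b = 0"
    unfolding inner_vec_def inner_real_def by (intro sum.neutral ballI)
  then show ?thesis
    using feas objective_inner by auto
qed

end

theorem theorem2:
  fixes E :: "'v::finite \<Rightarrow> 'v \<Rightarrow> bool"
    and n \<kappa> l \<mu> k :: nat
    and m :: "nat \<Rightarrow> nat"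
    and r s :: real
  assumes "strongly_regular E n \<kappa> l \<mu>"
    and "restricted_eigenvalue E r" and "r \<ge> 0"
    and "restricted_eigenvalue E s" and "s < 0"
    and "k > 0"
    and "\<And>i. i \<in> {1..k} \<Longrightarrow> m i > 0"
    and "(\<Sum>j\<in>{1..k}. m j) = n"
  shows "is_GPPm_min E k m
           (max ((real \<kappa> - r) / real n *
                   (\<Sum>(i, j)\<in>{(i, j). 1 \<le> i \<and> i < j \<and> j \<le> k}. real (m i) * real (m j)))
                (1 / 2 * (real n * (real \<kappa> + 1) - (\<Sum>i\<in>{1..k}. (real (m i))\<^sup>2))))
       \<and> is_GPPm_max E k m
           (min ((real \<kappa> - s) / real n *
                   (\<Sum>(i, j)\<in>{(i, j). 1 \<le> i \<and> i < j \<and> j \<le> k}. real (m i) * real (m j)))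
                (1 / 2 * real \<kappa> * real n))"
proof -
  interpret strongly_regular_partition E n \<kappa> l \<mu> r s k m
    using assms by unfold_locales auto
  let ?lo = "max ((real \<kappa> - r) / real n * (((real n)\<^sup>2 - S) / 2))
    (1 / 2 * (real n * (real \<kappa> + 1) - S))"
  let ?hi = "min ((real \<kappa> - s) / real n * (((real n)\<^sup>2 - S) / 2)) (1 / 2 * real \<kappa> * real n)"
  have lo: "?lo \<le> GPPm_objective E Y" if "GPPm_feasible k m Y" for Y
    using objective_ge_spectral[OF that] objective_ge_linear[OF that] by (rule max.boundedI)
  have hi: "GPPm_objective E Y \<le> ?hi" if "GPPm_feasible k m Y" for Y
    using objective_le_spectral[OF that] objective_le_linear[OF that] by (rule min.boundedI)
  \<comment> \<open>Equality with one of the two bounds gives only this inequality; the reverse one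
    is \<open>lo\<close>.\<close>
  obtain Y where Y: "GPPm_feasible k m Y" "GPPm_objective E Y \<le> ?lo"
    using exists_min unfolding le_max_iff_disj by (metis order_refl)
  have "GPPm_objective E Y = ?lo"
    using Y(2) lo[OF Y(1)] by (rule antisym)
  then have min: "is_GPPm_min E k m ?lo"
    unfolding is_GPPm_min_def is_arg_min_def using Y(1) lo by (metis not_less)
  obtain Z where Z: "GPPm_feasible k m Z" "?hi \<le> GPPm_objective E Z"
    using exists_max unfolding min_le_iff_disj by (metis order_refl)
  have "GPPm_objective E Z = ?hi"
    using hi[OF Z(1)] Z(2) by (rule antisym)
  then have max: "is_GPPm_max E k m ?hi"
    unfolding is_GPPm_max_def is_arg_max_def using Z(1) hi by (metis not_less)
  show ?thesis
    unfolding cross_sum using min max unfolding S_def by (rule conjI)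
qed

end
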